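(* Let $n\ge1$ and let $U\subset\mathbb{R}^n$ be an open and bounded definable set. Then $U$ is semi-monotone if and only if the following condition holds. If $n=1$: $U$ is a (possibly empty) open interval. If $n\ge 2$: there exist a semi-monotone set $U'\subset\mathbb{R}^{n-1}$, a submonotone function $f:U'\to\mathbb{R}$ and a supermonotone function $g:U'\to\mathbb{R}$ with $f(\mathbf{x})<g(\mathbf{x})$ for all $\mathbf{x}\in U'$, such that $$U=\{(\mathbf{x},t) : \mathbf{x}\in U',\ f(\mathbf{x})<t<g(\mathbf{x})\}.$$
   Context: Fix an o-minimal structure over $\mathbb{R}$; all sets and functions are definable in it. For $1\le j\le n$, $\sigma\in\{<,=,>\}$, $c\in\mathbb{R}$ put $X_{j,\sigma,c}:=\{(x_1,\dots,x_n)\in\mathbb{R}^n : x_j\,\sigma\,c\}$. A (definable) open, possibly empty, bounded set $U\subset\mathbb{R}^n$ is called semi-monotone if $U\cap X_{j_1,\sigma_1,c_1}\cap\cdots\cap X_{j_k,\sigma_k,c_k}$ is connected for any $0\le k\le n$, any $1\le j_1<\dots<j_k\le n$, any $\sigma_1,\dots,\sigma_k\in\{<,=,>\}$ and any $c_1,\dots,c_k\in\mathbb{R}$ (the empty set counts as connected). A bounded upper semi-continuous (definable) function $f$ on a semi-monotone set $V\subset\mathbb{R}^m$ is called submonotone if for any real $r>\inf_{\mathbf{x}\in V}f(\mathbf{x})$ the set $\{\mathbf{x}\in V : f(\mathbf{x})<r\}$ is semi-monotone. A function $g$ is called supermonotone if $-g$ is submonotone. *)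

theory Defs
  imports "HOL-Analysis.Analysis"
begin

text \<open>
  Points of \<open>R^n\<close> are the points of \<^term>\<open>Euclidean_space n\<close>: functions \<open>x :: nat \<Rightarrow> real\<close> with
  \<open>x i = 0\<close> for \<open>i \<ge> n\<close>.  The coordinates \<open>x_1, \<dots>, x_n\<close> are \<open>x 0, \<dots>, x (n - 1)\<close>, and for
  \<open>x\<close> in \<open>R^n\<close> the point \<open>(x, t)\<close> of \<open>R^(n + 1)\<close> is \<open>x(n := t)\<close>.
\<close>

abbreviation RR :: "nat \<Rightarrow> (nat \<Rightarrow> real) set" where
  "RR n \<equiv> topspace (Euclidean_space n)"

text \<open>
  An o-minimal structure on the ordered set of real numbers, in the sense of van den Dries;
  \<open>S m\<close> is the collection of definable subsets of \<open>R^m\<close>.  Parameters from \<open>R\<close> are allowed, because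
  every point is in \<open>S 1\<close>.  Addition and multiplication may be definable but need not be.
\<close>

locale o_minimal_structure =
  fixes S :: "nat \<Rightarrow> (nat \<Rightarrow> real) set set"
  assumes subset_space: "A \<in> S m \<Longrightarrow> A \<subseteq> RR m"
    and empty_mem: "{} \<in> S m"
    and compl_mem: "A \<in> S m \<Longrightarrow> RR m - A \<in> S m"
    and union_mem: "A \<in> S m \<Longrightarrow> B \<in> S m \<Longrightarrow> A \<union> B \<in> S m"
    and times_line: "A \<in> S m \<Longrightarrow> {x(m := t) |x t. x \<in> A} \<in> S (Suc m)"
    and line_times: "A \<in> S m \<Longrightarrow> {x \<in> RR (Suc m). (\<lambda>i. x (Suc i)) \<in> A} \<in> S (Suc m)"
    and diagonal: "m \<ge> 1 \<Longrightarrow> {x \<in> RR m. x 0 = x (m - 1)} \<in> S m"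
    and projection: "A \<in> S (Suc m) \<Longrightarrow> (\<lambda>x. x(m := 0)) ` A \<in> S m"
    and order: "{x \<in> RR 2. x 0 < x 1} \<in> S 2"
    and o_minimal: "A \<in> S 1 \<longleftrightarrow>
      (\<exists>\<I>. finite \<I> \<and> (\<forall>I\<in>\<I>. is_interval I) \<and> A = {x \<in> RR 1. x 0 \<in> \<Union>\<I>})"

definition definable_fun ::
  "(nat \<Rightarrow> (nat \<Rightarrow> real) set set) \<Rightarrow> nat \<Rightarrow> (nat \<Rightarrow> real) set \<Rightarrow> ((nat \<Rightarrow> real) \<Rightarrow> real) \<Rightarrow> bool" where
  "definable_fun S m V f \<longleftrightarrow> {x(m := f x) |x. x \<in> V} \<in> S (Suc m)"

text \<open>
  The library's \<^term>\<open>bounded\<close> is unsuitable here: the metric on the type \<^typ>\<open>nat \<Rightarrow> real\<close> is itself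
  bounded, so that every set of functions would be bounded.
\<close>

definition bounded_in :: "nat \<Rightarrow> (nat \<Rightarrow> real) set \<Rightarrow> bool" where
  "bounded_in n U \<longleftrightarrow> (\<exists>B. \<forall>x\<in>U. \<forall>i<n. \<bar>x i\<bar> \<le> B)"

definition coord_set :: "nat \<Rightarrow> nat \<Rightarrow> (real \<Rightarrow> real \<Rightarrow> bool) \<Rightarrow> real \<Rightarrow> (nat \<Rightarrow> real) set" where
  "coord_set n j \<sigma> c = {x \<in> RR n. \<sigma> (x j) c}"

text \<open>
  \<open>J\<close> is the set of the indices \<open>j_1 < \<dots> < j_k\<close>.
\<close>

definition semi_monotone :: "(nat \<Rightarrow> (nat \<Rightarrow> real) set set) \<Rightarrow> nat \<Rightarrow> (nat \<Rightarrow> real) set \<Rightarrow> bool" where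
  "semi_monotone S n U \<longleftrightarrow>
     U \<in> S n \<and> openin (Euclidean_space n) U \<and> bounded_in n U \<and>
     (\<forall>J \<sigma> c. J \<subseteq> {..<n} \<and> (\<forall>j\<in>J. \<sigma> j \<in> {(<), (=), (>)}) \<longrightarrow>
        connectedin (Euclidean_space n) (U \<inter> (\<Inter>j\<in>J. coord_set n j (\<sigma> j) (c j))))"

definition upper_semicontinuous_on ::
  "nat \<Rightarrow> (nat \<Rightarrow> real) set \<Rightarrow> ((nat \<Rightarrow> real) \<Rightarrow> real) \<Rightarrow> bool" where
  "upper_semicontinuous_on m V f \<longleftrightarrow>
     (\<forall>x\<in>V. \<forall>r>f x. \<exists>W. openin (Euclidean_space m) W \<and> x \<in> W \<and> (\<forall>y\<in>W \<inter> V. f y < r))"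

text \<open>
  Definability of the function is not part of the next two notions and is to be required
  separately by \<^const>\<open>definable_fun\<close>: in a structure in which negation is not definable, a definable
  \<open>g\<close> can have a non-definable \<open>- g\<close>, whereas the sublevel sets of \<open>- g\<close> are still definable.
  If \<open>V\<close> is empty, the value of the infimum is irrelevant, since all sublevel sets are empty.
\<close>

definition submonotone ::
  "(nat \<Rightarrow> (nat \<Rightarrow> real) set set) \<Rightarrow> nat \<Rightarrow> (nat \<Rightarrow> real) set \<Rightarrow> ((nat \<Rightarrow> real) \<Rightarrow> real) \<Rightarrow> bool" where
  "submonotone S m V f \<longleftrightarrow>
     semi_monotone S m V \<and> bounded (f ` V) \<and> upper_semicontinuous_on m V f \<and>
     (\<forall>r > (INF x\<in>V. f x). semi_monotone S m {x \<in> V. f x < r})"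

definition supermonotone ::
  "(nat \<Rightarrow> (nat \<Rightarrow> real) set set) \<Rightarrow> nat \<Rightarrow> (nat \<Rightarrow> real) set \<Rightarrow> ((nat \<Rightarrow> real) \<Rightarrow> real) \<Rightarrow> bool" where
  "supermonotone S m V g \<longleftrightarrow> submonotone S m V (\<lambda>x. - g x)"

end

theory Submission
  imports Defs
begin

text \<open>
  Everything rests on the projection \<open>p\<close> of \<open>R^(m + 1)\<close> that forgets the last coordinate \<open>t\<close>.  Let
  \<open>G\<close> be open in \<open>R^(m + 1)\<close> and let \<open>T\<close> be a condition on \<open>t\<close>: none, \<open>t < c\<close>, \<open>t = c\<close> or \<open>t > c\<close>.
  The image of \<open>G \<inter> {t \<in> T}\<close> under \<open>p\<close> is open, because it is a union of slices of \<open>G\<close>.  The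
  restriction of \<open>p\<close> to \<open>G \<inter> {t \<in> T}\<close> is therefore an open map, and if its fibres are intervals, then
  connectedness can be lifted from the base to the total space (\<open>connected_over_shadow\<close>); it always
  descends from the total space to the base.

  A semi-monotone \<open>U\<close> has nonempty open bounded intervals as fibres over its projection \<open>U'\<close>, and \<open>f\<close> and
  \<open>g\<close> are their end points.  The set \<open>{f < r}\<close> is the projection of \<open>U \<inter> {t < r}\<close>, and \<open>{g > r}\<close> that of
  \<open>U \<inter> {t > r}\<close>, so these sets are open and have connected sections because \<open>U\<close> is open and has connected sections.

  Conversely, let \<open>U\<close> lie between \<open>f\<close> and \<open>g\<close>.  To lift connectedness to the sections of \<open>U\<close>, one needs
  the sections of the bases \<open>U'\<close>, \<open>{f < c}\<close>, \<open>{g > c}\<close> and \<open>{f < c} \<inter> {g > c}\<close> to be connected.  Only the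
  last one is not given.  It is the intersection of two open sets with connected sections whose
  union \<open>U'\<close> has connected sections too, since \<open>f < g\<close>.  That such an intersection again has connected
  sections (\<open>section_connected_Int\<close>) is a form of unicoherence, but it needs no algebraic topology:
  by induction on the dimension one may pass to the projections, because over a point of
  both projections the two fibres are nonempty and open in their union, which is connected, and
  hence they overlap.

  Semi-monotonicity of the projections and definability of \<open>f\<close> and \<open>g\<close> also require that definable sets
  are closed under substitution of coordinates (\<open>coords_vimage_definable\<close>), which is derived from the
  axioms of an o-minimal structure.
\<close>

section \<open>Euclidean spaces of functions\<close>

lemma mem_RR: "x \<in> RR n \<longleftrightarrow> (\<forall>i\<ge>n. x i = 0)"
  by (simp add: topspace_Euclidean_space)

lemma Euclidean_space_top_of_set: "Euclidean_space n = top_of_set {x. \<forall>i\<ge>n. x i = 0}"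
  by (simp add: Euclidean_space_def euclidean_product_topology)

lemma connectedin_Euclidean_iff:
  "connectedin (Euclidean_space n) A \<longleftrightarrow> A \<subseteq> RR n \<and> connected A"
  by (auto simp: Euclidean_space_top_of_set connectedin_subtopology)

lemma continuous_on_upd:
  fixes h :: "'a::topological_space \<Rightarrow> nat \<Rightarrow> real"
  assumes "continuous_on A h" "continuous_on A k"
  shows "continuous_on A (\<lambda>x. (h x)(m := k x))"
proof (rule continuous_on_coordinatewise_then_product)
  fix i
  show "continuous_on A (\<lambda>x. ((h x)(m := k x)) i)"
    using assms continuous_on_product_then_coordinatewise[OF assms(1), of i] by (cases "i = m") auto
qed

lemma continuous_map_upd: "continuous_map (Euclidean_space m) (Euclidean_space (Suc m)) (\<lambda>x. x(m := t))"
proof -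
  have "continuous_on {x. \<forall>i\<ge>m. x i = 0} (\<lambda>x. x(m := t))"
    by (intro continuous_on_upd continuous_on_id continuous_on_const)
  then show ?thesis
    unfolding Euclidean_space_top_of_set continuous_map_subtopology_eu by auto
qed

lemma openin_slice:
  assumes "openin (Euclidean_space (Suc m)) G"
  shows "openin (Euclidean_space m) {x \<in> RR m. x(m := t) \<in> G}"
  using openin_continuous_map_preimage[OF continuous_map_upd assms] .

lemma open_fibre:
  assumes "openin (Euclidean_space (Suc m)) G" "x \<in> RR m"
  shows "open {t. x(m := t) \<in> G}"
proof -
  have "continuous_on UNIV (\<lambda>t. x(m := t))"
    by (intro continuous_on_upd continuous_on_id continuous_on_const)
  then have "continuous_map euclidean (Euclidean_space (Suc m)) (\<lambda>t. x(m := t))"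
    using assms(2) unfolding Euclidean_space_top_of_set continuous_map_in_subtopology mem_RR
    by auto
  from openin_continuous_map_preimage[OF this assms(1)] show ?thesis
    by simp
qed

lemma last_coordinate_split:
  assumes "y \<in> RR (Suc m)"
  shows "y(m := 0) \<in> RR m" "(y(m := 0))(m := y m) = y"
  using assms by (auto simp: mem_RR Suc_le_eq)

section \<open>Projections along the last coordinate\<close>

text \<open>
  The image of \<open>{y \<in> G. y m \<in> T}\<close> under the projection, for \<open>G\<close> in \<open>R^(m + 1)\<close>; see
  \<open>shadow_eq_image\<close>.  In this form it is visibly a union of slices of \<open>G\<close>.
\<close>

definition shadow :: "nat \<Rightarrow> real set \<Rightarrow> (nat \<Rightarrow> real) set \<Rightarrow> (nat \<Rightarrow> real) set" where
  "shadow m T G = {x \<in> RR m. \<exists>t\<in>T. x(m := t) \<in> G}"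

lemma shadow_Un: "shadow m T (A \<union> B) = shadow m T A \<union> shadow m T B"
  by (auto simp: shadow_def)

text \<open>
  A union of open slices is open for every \<open>T\<close>.  Thus the equality \<open>t = c\<close> can be treated like the strict
  inequalities, although \<open>{y \<in> G. y m = c}\<close> is not open.
\<close>

lemma openin_shadow:
  assumes "openin (Euclidean_space (Suc m)) G"
  shows "openin (Euclidean_space m) (shadow m T G)"
proof -
  have "shadow m T G = (\<Union>t\<in>T. {x \<in> RR m. x(m := t) \<in> G})"
    by (auto simp: shadow_def)
  then show ?thesis
    using openin_slice[OF assms] by auto
qed

lemma shadow_eq_image:
  assumes "G \<subseteq> RR (Suc m)"
  shows "shadow m T G = (\<lambda>y. y(m := 0)) ` {y \<in> G. y m \<in> T}"
proof (intro equalityI subsetI)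
  fix x assume "x \<in> shadow m T G"
  then obtain t where t: "x \<in> RR m" "t \<in> T" "x(m := t) \<in> G" by (auto simp: shadow_def)
  moreover from t(1) have "x = (x(m := t))(m := 0)" by (auto simp: mem_RR)
  ultimately show "x \<in> (\<lambda>y. y(m := 0)) ` {y \<in> G. y m \<in> T}"
    by (intro image_eqI[of _ _ "x(m := t)"]) auto
next
  fix x assume "x \<in> (\<lambda>y. y(m := 0)) ` {y \<in> G. y m \<in> T}"
  then obtain y where y: "y \<in> G" "y m \<in> T" "x = y(m := 0)" by auto
  have "y \<in> RR (Suc m)" using y(1) assms by blast
  with y show "x \<in> shadow m T G"
    using last_coordinate_split(1) unfolding shadow_def
    by (auto intro!: bexI[of _ "y m"])
qed

text \<open>
  A separation of the total space by open sets \<open>P\<close> and \<open>Q\<close> projects to a cover of the connected base by two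
  nonempty relatively open sets.  These have a common point, whose fibre meets both \<open>P\<close> and \<open>Q\<close>, contrary
  to its connectedness.
\<close>

lemma connected_over_shadow:
  assumes G: "openin (Euclidean_space (Suc m)) G"
    and fibres: "\<And>x. x \<in> Z \<Longrightarrow> x \<in> RR m \<Longrightarrow> connected {t \<in> T. x(m := t) \<in> G}"
    and base: "connected (shadow m T G \<inter> Z)"
  shows "connected {y \<in> G. y m \<in> T \<and> y(m := 0) \<in> Z}" (is "connected ?W")
proof (rule connectedI)
  fix P Q assume PQ: "open P" "open Q" and ne: "P \<inter> ?W \<noteq> {}" "Q \<inter> ?W \<noteq> {}"
    and disj: "P \<inter> Q \<inter> ?W = {}" and cov: "?W \<subseteq> P \<union> Q"
  have GR: "G \<subseteq> RR (Suc m)" using G openin_subset by blast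
  have rel_open: "openin (top_of_set (shadow m T G \<inter> Z)) (shadow m T (G \<inter> O1) \<inter> Z)" if "open O1" for O1
  proof -
    have "openin (Euclidean_space (Suc m)) (G \<inter> O1)"
      using G that unfolding Euclidean_space_top_of_set by (rule openin_Int_open)
    then have "openin (top_of_set (RR m)) (shadow m T (G \<inter> O1))"
      using openin_shadow[of m "G \<inter> O1" T] by (simp add: Euclidean_space_top_of_set)
    then obtain O2 where "open O2" "shadow m T (G \<inter> O1) = RR m \<inter> O2"
      unfolding openin_open by blast
    moreover have "shadow m T (G \<inter> O1) \<subseteq> shadow m T G" "shadow m T G \<subseteq> RR m" by (auto simp: shadow_def)
    ultimately have "open O2" "shadow m T (G \<inter> O1) \<inter> Z = shadow m T G \<inter> Z \<inter> O2" by blast+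
    then show ?thesis unfolding openin_open by blast
  qed
  have mem: "y(m := 0) \<in> shadow m T (G \<inter> O1) \<inter> Z" if "y \<in> ?W" "y \<in> O1" for y O1
    using that GR shadow_eq_image[of "G \<inter> O1" m T] by auto
  have 1: "shadow m T (G \<inter> P) \<inter> Z \<noteq> {}" "shadow m T (G \<inter> Q) \<inter> Z \<noteq> {}"
    using ne mem by blast+
  have 2: "shadow m T G \<inter> Z \<subseteq> (shadow m T (G \<inter> P) \<inter> Z) \<union> (shadow m T (G \<inter> Q) \<inter> Z)"
  proof
    fix x assume x: "x \<in> shadow m T G \<inter> Z"
    then obtain y where y: "y \<in> ?W" "x = y(m := 0)" using shadow_eq_image[OF GR] by auto
    with cov mem show "x \<in> (shadow m T (G \<inter> P) \<inter> Z) \<union> (shadow m T (G \<inter> Q) \<inter> Z)" by blast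
  qed
  obtain x where x: "x \<in> Z" "x \<in> shadow m T (G \<inter> P)" "x \<in> shadow m T (G \<inter> Q)"
    using base 1 2 rel_open[OF PQ(1)] rel_open[OF PQ(2)] unfolding connected_openin by blast
  have xR: "x \<in> RR m" using x by (auto simp: shadow_def)
  have fib: "x(m := t) \<in> ?W" if "t \<in> T" "x(m := t) \<in> G" for t
    using that x xR by (simp add: mem_RR fun_upd_idem)
  have op: "open {t. x(m := t) \<in> R}" if "open R" for R
  proof -
    have "open ((\<lambda>t. x(m := t)) -` R)"
      by (intro open_vimage that continuous_on_upd continuous_on_id continuous_on_const)
    then show ?thesis by (simp add: vimage_def)
  qed
  let ?F = "{t \<in> T. x(m := t) \<in> G}"
  have "connected ?F" using fibres x xR by blast
  moreover have "{t. x(m := t) \<in> P} \<inter> {t. x(m := t) \<in> Q} \<inter> ?F = {}"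
    using fib disj by blast
  moreover have "?F \<subseteq> {t. x(m := t) \<in> P} \<union> {t. x(m := t) \<in> Q}"
    using fib cov by blast
  moreover have "{t. x(m := t) \<in> P} \<inter> ?F \<noteq> {}" "{t. x(m := t) \<in> Q} \<inter> ?F \<noteq> {}"
    using x by (auto simp: shadow_def)
  ultimately show False
    using connectedD op[OF PQ(1)] op[OF PQ(2)] by blast
qed

section \<open>Sets with connected coordinate sections\<close>

text \<open>
  The set \<open>UNIV\<close> is the absence of a condition.  With it, a section is given by one condition for each
  coordinate, and the index set of the restricted coordinates disappears.
\<close>

definition coord_conditions :: "real set set" where
  "coord_conditions = insert UNIV {{t. \<sigma> t c} |\<sigma> c. \<sigma> \<in> {(<), (=), (>)}}"

lemma coord_conditions_simps [simp]:
  "UNIV \<in> coord_conditions" "{..<r} \<in> coord_conditions" "{r<..} \<in> coord_conditions"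
  "{r} \<in> coord_conditions"
proof -
  have "{t. \<sigma> t r} \<in> coord_conditions" if "\<sigma> \<in> {(<), (=), (>)}" for \<sigma>
    unfolding coord_conditions_def by (intro insertI2 CollectI exI[of _ \<sigma>] exI[of _ r] conjI refl that)
  from this[of "(<)"] this[of "(>)"] this[of "(=)"]
  show "{..<r} \<in> coord_conditions" "{r<..} \<in> coord_conditions" "{r} \<in> coord_conditions"
    by (simp_all add: lessThan_def greaterThan_def)
qed (simp add: coord_conditions_def)

lemma coord_conditions_cases:
  assumes "T \<in> coord_conditions"
  obtains "T = UNIV" | c where "T = {..<c}" | c where "T = {c<..}" | c where "T = {c}"
  using assms unfolding coord_conditions_def by (auto simp: lessThan_def greaterThan_def)

lemma is_interval_coord_condition: "T \<in> coord_conditions \<Longrightarrow> is_interval T"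
  by (erule coord_conditions_cases) (auto simp: is_interval_1)

definition section_connected :: "nat \<Rightarrow> (nat \<Rightarrow> real) set \<Rightarrow> bool" where
  "section_connected n U \<longleftrightarrow>
     (\<forall>T. (\<forall>i. T i \<in> coord_conditions) \<longrightarrow> connected {x \<in> U. \<forall>i<n. x i \<in> T i})"

lemma section_connectedD:
  "section_connected n U \<Longrightarrow> (\<And>i. T i \<in> coord_conditions) \<Longrightarrow> connected {x \<in> U. \<forall>i<n. x i \<in> T i}"
  by (simp add: section_connected_def)

lemma semi_monotone_iff:
  "semi_monotone S n U \<longleftrightarrow>
     U \<in> S n \<and> openin (Euclidean_space n) U \<and> bounded_in n U \<and> section_connected n U"
proof -
  have "(\<forall>J \<sigma> c. J \<subseteq> {..<n} \<and> (\<forall>j\<in>J. \<sigma> j \<in> {(<), (=), (>)}) \<longrightarrow>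
        connectedin (Euclidean_space n) (U \<inter> (\<Inter>j\<in>J. coord_set n j (\<sigma> j) (c j)))) \<longleftrightarrow>
      section_connected n U" (is "?L \<longleftrightarrow> _") if "U \<subseteq> RR n"
  proof
    assume L: ?L
    show "section_connected n U"
      unfolding section_connected_def
    proof (intro allI impI)
      fix T assume T: "\<forall>i::nat. T i \<in> coord_conditions"
      define J where "J = {i. i < n \<and> T i \<noteq> UNIV}"
      have "\<forall>i\<in>J. \<exists>\<sigma> c. \<sigma> \<in> {(<), (=), (>)} \<and> T i = {t. \<sigma> t c}"
      proof
        fix i assume "i \<in> J"
        then have "T i \<in> {{t. \<sigma> t c} |\<sigma> c. \<sigma> \<in> {(<), (=), (>)}}"
          using T[rule_format, of i] unfolding J_def coord_conditions_def by simp
        then show "\<exists>\<sigma> c. \<sigma> \<in> {(<), (=), (>)} \<and> T i = {t. \<sigma> t c}"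
          by (elim CollectE exE conjE) (intro exI conjI)
      qed
      from bchoice[OF this] obtain \<sigma> where
        "\<forall>i\<in>J. \<exists>c. \<sigma> i \<in> {(<), (=), (>)} \<and> T i = {t. \<sigma> i t c}" ..
      from bchoice[OF this] obtain c where
        sc: "\<forall>i\<in>J. \<sigma> i \<in> {(<), (=), (>)} \<and> T i = {t. \<sigma> i t (c i)}" ..
      have "U \<inter> (\<Inter>j\<in>J. coord_set n j (\<sigma> j) (c j)) = {x \<in> U. \<forall>i<n. x i \<in> T i}"
      proof (intro equalityI subsetI)
        fix x assume "x \<in> U \<inter> (\<Inter>j\<in>J. coord_set n j (\<sigma> j) (c j))"
        then show "x \<in> {x \<in> U. \<forall>i<n. x i \<in> T i}"
          using sc by (fastforce simp: coord_set_def J_def)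
      next
        fix x assume "x \<in> {x \<in> U. \<forall>i<n. x i \<in> T i}"
        then show "x \<in> U \<inter> (\<Inter>j\<in>J. coord_set n j (\<sigma> j) (c j))"
          using sc that by (fastforce simp: coord_set_def J_def)
      qed
      moreover have "J \<subseteq> {..<n}" by (auto simp: J_def)
      ultimately show "connected {x \<in> U. \<forall>i<n. x i \<in> T i}"
        using L sc by (metis (no_types, lifting) connectedin_Euclidean_iff)
    qed
  next
    assume R: "section_connected n U"
    show ?L
    proof (intro allI impI, elim conjE)
      fix J :: "nat set" and \<sigma> :: "nat \<Rightarrow> real \<Rightarrow> real \<Rightarrow> bool" and c :: "nat \<Rightarrow> real"
      assume J: "J \<subseteq> {..<n}" and s: "\<forall>j\<in>J. \<sigma> j \<in> {(<), (=), (>)}"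
      define T where "T = (\<lambda>i. if i \<in> J then {t. \<sigma> i t (c i)} else UNIV)"
      have "T i \<in> coord_conditions" for i
        using s by (auto simp: T_def coord_conditions_def)
      from section_connectedD[OF R, of T, OF this]
      have "connected {x \<in> U. \<forall>i<n. x i \<in> T i}" .
      moreover have "U \<inter> (\<Inter>j\<in>J. coord_set n j (\<sigma> j) (c j)) = {x \<in> U. \<forall>i<n. x i \<in> T i}"
        using that J by (auto simp: coord_set_def T_def split: if_splits)
      ultimately show "connectedin (Euclidean_space n) (U \<inter> (\<Inter>j\<in>J. coord_set n j (\<sigma> j) (c j)))"
        using that by (auto simp: connectedin_Euclidean_iff)
    qed
  qed
  moreover have "openin (Euclidean_space n) U \<Longrightarrow> U \<subseteq> RR n" by (rule openin_subset)
  ultimately show ?thesis unfolding semi_monotone_def by blast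
qed

text \<open>
  A section of the projection is the projection of a section.
\<close>

lemma section_connected_shadow:
  assumes G: "section_connected (Suc m) G" "G \<subseteq> RR (Suc m)" and T: "T \<in> coord_conditions"
  shows "section_connected m (shadow m T G)"
  unfolding section_connected_def
proof (intro allI impI)
  fix T' assume T': "\<forall>i::nat. T' i \<in> coord_conditions"
  have "connected {y \<in> G. \<forall>i<Suc m. y i \<in> (T'(m := T)) i}"
    using T T' by (intro section_connectedD[OF G(1)]) auto
  then have "connected ((\<lambda>y. y(m := 0)) ` {y \<in> G. \<forall>i<Suc m. y i \<in> (T'(m := T)) i})"
    by (intro connected_continuous_image continuous_on_upd continuous_on_id continuous_on_const)
  also have "(\<lambda>y. y(m := 0)) ` {y \<in> G. \<forall>i<Suc m. y i \<in> (T'(m := T)) i} = {x \<in> shadow m T G. \<forall>i<m. x i \<in> T' i}"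
    unfolding shadow_eq_image[OF G(2)] by (fastforce simp: less_Suc_eq image_iff)
  finally show "connected {x \<in> shadow m T G. \<forall>i<m. x i \<in> T' i}" .
qed

text \<open>
  A fibre is, up to projection to the last coordinate, the section that fixes all the other coordinates.
\<close>

lemma section_connected_fibre:
  assumes G: "section_connected (Suc m) G" and T: "T \<in> coord_conditions" and x: "x \<in> RR m"
    and sub: "G \<subseteq> RR (Suc m)"
  shows "connected {t \<in> T. x(m := t) \<in> G}"
proof -
  let ?T = "(\<lambda>i. {x i})(m := T)"
  have eq: "y = x(m := y m)" if "y \<in> G" "\<forall>i<Suc m. y i \<in> ?T i" for y
  proof
    fix i
    have "y \<in> RR (Suc m)" using that sub by blast
    then show "y i = (x(m := y m)) i"
      using that(2) x by (cases i m rule: linorder_cases) (auto simp: mem_RR less_Suc_eq)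
  qed
  have "connected ((\<lambda>y. y m) ` {y \<in> G. \<forall>i<Suc m. y i \<in> ?T i})"
    using T by (intro connected_continuous_image section_connectedD[OF G] continuous_on_product_coordinates)
      (auto intro: continuous_on_subset[OF continuous_on_product_coordinates])
  also have "(\<lambda>y. y m) ` {y \<in> G. \<forall>i<Suc m. y i \<in> ?T i} = {t \<in> T. x(m := t) \<in> G}"
  proof (intro equalityI subsetI)
    fix t assume "t \<in> (\<lambda>y. y m) ` {y \<in> G. \<forall>i<Suc m. y i \<in> ?T i}"
    then obtain y where y: "t = y m" "y \<in> G" "\<forall>i<Suc m. y i \<in> ?T i" by auto
    have "y m \<in> T" using y(3)[rule_format, of m] by simp
    moreover have "x(m := t) = y" unfolding y(1) by (rule eq[OF y(2,3), symmetric])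
    ultimately show "t \<in> {t \<in> T. x(m := t) \<in> G}" using y by simp
  next
    fix t assume "t \<in> {t \<in> T. x(m := t) \<in> G}"
    then show "t \<in> (\<lambda>y. y m) ` {y \<in> G. \<forall>i<Suc m. y i \<in> ?T i}"
      by (intro image_eqI[of _ _ "x(m := t)"]) auto
  qed
  finally show ?thesis .
qed

text \<open>
  The step from dimension \<open>m\<close> to \<open>m + 1\<close>.  The condition on the last coordinate is absorbed by the
  shadow, those on the others by its section.
\<close>

lemma section_connected_Suc:
  assumes G: "openin (Euclidean_space (Suc m)) G"
    and fibres: "\<And>x. x \<in> RR m \<Longrightarrow> connected {t. x(m := t) \<in> G}"
    and shadows: "\<And>T. T \<in> coord_conditions \<Longrightarrow> section_connected m (shadow m T G)"
  shows "section_connected (Suc m) G"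
  unfolding section_connected_def
proof (intro allI impI)
  fix T assume T: "\<forall>i::nat. T i \<in> coord_conditions"
  let ?Z = "{x. \<forall>i<m. x i \<in> T i}"
  have "connected {y \<in> G. y m \<in> T m \<and> y(m := 0) \<in> ?Z}"
  proof (rule connected_over_shadow[OF G])
    fix x :: "nat \<Rightarrow> real" assume "x \<in> RR m"
    have "is_interval (T m)"
      using T by (simp add: is_interval_coord_condition)
    moreover have "is_interval {t. x(m := t) \<in> G}"
      using fibres[OF \<open>x \<in> RR m\<close>] is_interval_connected_1 by blast
    ultimately have "is_interval (T m \<inter> {t. x(m := t) \<in> G})" by (rule is_interval_Int)
    moreover have "T m \<inter> {t. x(m := t) \<in> G} = {t \<in> T m. x(m := t) \<in> G}" by blast
    ultimately show "connected {t \<in> T m. x(m := t) \<in> G}"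
      by (simp add: is_interval_connected_1)
  next
    have "connected {x \<in> shadow m (T m) G. \<forall>i<m. x i \<in> T i}"
      using T by (intro section_connectedD[OF shadows]) auto
    then show "connected (shadow m (T m) G \<inter> ?Z)"
      by (simp add: Int_def)
  qed
  moreover have "{y \<in> G. y m \<in> T m \<and> y(m := 0) \<in> ?Z} = {x \<in> G. \<forall>i<Suc m. x i \<in> T i}"
    by (auto simp: less_Suc_eq)
  ultimately show "connected {x \<in> G. \<forall>i<Suc m. x i \<in> T i}" by simp
qed

lemma section_connected_0:
  assumes "A \<subseteq> RR 0"
  shows "section_connected 0 A"
  unfolding section_connected_def
proof (intro allI impI)
  fix T :: "nat \<Rightarrow> real set"
  have "A \<subseteq> {\<lambda>_. 0}" using assms unfolding subset_iff mem_RR by blast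
  then have "{x \<in> A. \<forall>i<0. x i \<in> T i} \<subseteq> {\<lambda>_. 0}" by auto
  then show "connected {x \<in> A. \<forall>i<0. x i \<in> T i}"
    by (auto dest!: subset_singletonD simp del: Collect_empty_eq)
qed

text \<open>
  The openness of \<open>A\<close> and \<open>B\<close> is what makes their fibres over a common point overlap: otherwise the two
  fibres would separate the fibre of \<open>A \<union> B\<close>.  Hence the shadow of \<open>A \<inter> B\<close> is the intersection of the
  shadows of \<open>A\<close> and \<open>B\<close>, to which the induction hypothesis applies.
\<close>

lemma section_connected_Int:
  assumes "openin (Euclidean_space m) A" "openin (Euclidean_space m) B"
    and "section_connected m A" "section_connected m B" "section_connected m (A \<union> B)"
  shows "section_connected m (A \<inter> B)"
  using assms
proof (induction m arbitrary: A B)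
  case 0
  show ?case
    using openin_subset[OF 0(1)] by (intro section_connected_0) blast
next
  case (Suc m)
  have sub: "A \<subseteq> RR (Suc m)" "B \<subseteq> RR (Suc m)" using Suc.prems openin_subset by blast+
  have overlap: "\<exists>t\<in>T. x(m := t) \<in> A \<inter> B"
    if T: "T \<in> coord_conditions" and x: "x \<in> shadow m T A" "x \<in> shadow m T B" for T x
  proof (rule ccontr)
    assume no: "\<not> (\<exists>t\<in>T. x(m := t) \<in> A \<inter> B)"
    have xR: "x \<in> RR m" using x by (auto simp: shadow_def)
    have "connected {t \<in> T. x(m := t) \<in> A \<union> B}"
      using section_connected_fibre[OF Suc.prems(5) T xR] sub by blast
    moreover have "{t. x(m := t) \<in> A} \<inter> {t. x(m := t) \<in> B} \<inter> {t \<in> T. x(m := t) \<in> A \<union> B} = {}"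
      using no by blast
    moreover have "{t \<in> T. x(m := t) \<in> A \<union> B} \<subseteq> {t. x(m := t) \<in> A} \<union> {t. x(m := t) \<in> B}"
      by blast
    moreover have "{t. x(m := t) \<in> A} \<inter> {t \<in> T. x(m := t) \<in> A \<union> B} \<noteq> {}"
      "{t. x(m := t) \<in> B} \<inter> {t \<in> T. x(m := t) \<in> A \<union> B} \<noteq> {}"
      using x by (auto simp: shadow_def)
    ultimately show False
      using connectedD open_fibre[OF Suc.prems(1) xR] open_fibre[OF Suc.prems(2) xR] by blast
  qed
  show ?case
  proof (rule section_connected_Suc)
    show "openin (Euclidean_space (Suc m)) (A \<inter> B)" using Suc.prems by blast
  next
    fix x :: "nat \<Rightarrow> real" assume x: "x \<in> RR m"
    have "is_interval ({t. x(m := t) \<in> A} \<inter> {t. x(m := t) \<in> B})"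
      using section_connected_fibre[of m A UNIV x] section_connected_fibre[of m B UNIV x] x sub Suc.prems
      by (intro is_interval_Int) (auto simp: is_interval_connected_1)
    moreover have "{t. x(m := t) \<in> A} \<inter> {t. x(m := t) \<in> B} = {t. x(m := t) \<in> A \<inter> B}" by blast
    ultimately show "connected {t. x(m := t) \<in> A \<inter> B}"
      by (simp add: is_interval_connected_1)
  next
    fix T assume T: "T \<in> coord_conditions"
    have "section_connected m (shadow m T A \<inter> shadow m T B)"
    proof (rule Suc.IH)
      show "section_connected m (shadow m T A \<union> shadow m T B)"
        unfolding shadow_Un[symmetric] using Suc.prems sub T by (intro section_connected_shadow) auto
    qed (use Suc.prems sub T in \<open>auto intro!: openin_shadow section_connected_shadow\<close>)
    moreover have "shadow m T (A \<inter> B) = shadow m T A \<inter> shadow m T B"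
      using overlap[OF T] by (auto simp: shadow_def)
    ultimately show "section_connected m (shadow m T (A \<inter> B))" by simp
  qed
qed

section \<open>Definability\<close>

text \<open>
  The point of \<open>R^k\<close> whose coordinate with index \<open>j\<close> is \<open>x (\<pi> j)\<close>: the coordinates of \<open>x\<close> are
  selected, permuted or repeated according to \<open>\<pi>\<close>.
\<close>

definition coords :: "nat \<Rightarrow> (nat \<Rightarrow> nat) \<Rightarrow> (nat \<Rightarrow> real) \<Rightarrow> (nat \<Rightarrow> real)" where
  "coords k \<pi> x = (\<lambda>j. if j < k then x (\<pi> j) else 0)"

lemma coords_id: "x \<in> RR k \<Longrightarrow> coords k (\<lambda>j. j) x = x"
  by (auto simp: coords_def mem_RR)

context o_minimal_structure
begin

lemma RR_definable: "RR m \<in> S m"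
  using compl_mem[OF empty_mem] by simp

lemma Int_definable:
  assumes "A \<in> S m" "B \<in> S m"
  shows "A \<inter> B \<in> S m"
proof -
  have "A \<inter> B = RR m - ((RR m - A) \<union> (RR m - B))"
    using subset_space[OF assms(1)] by blast
  then show ?thesis using assms by (simp only: compl_mem union_mem)
qed

lemma Diff_definable:
  assumes "A \<in> S m" "B \<in> S m"
  shows "A - B \<in> S m"
proof -
  have "A - B = A \<inter> (RR m - B)"
    using subset_space[OF assms(1)] by blast
  then show ?thesis using assms by (simp only: compl_mem Int_definable)
qed

lemma times_space_definable:
  assumes "A \<in> S k"
  shows "{x \<in> RR (k + d). coords k (\<lambda>j. j) x \<in> A} \<in> S (k + d)"
proof (induction d)
  case 0
  have "{x \<in> RR (k + 0). coords k (\<lambda>j. j) x \<in> A} = A"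
    using subset_space[OF assms] coords_id by fastforce
  then show ?case using assms by simp
next
  case (Suc d)
  let ?P = "\<lambda>d. {x \<in> RR (k + d). coords k (\<lambda>j. j) x \<in> A}"
  have "?P (Suc d) = {x(k + d := t) |x t. x \<in> ?P d}"
  proof (intro equalityI subsetI)
    fix y assume y: "y \<in> ?P (Suc d)"
    then have "y(k + d := 0) \<in> RR (k + d)" using last_coordinate_split(1)[of y "k + d"] by simp
    moreover have "coords k (\<lambda>j. j) (y(k + d := 0)) = coords k (\<lambda>j. j) y"
      by (auto simp: coords_def)
    moreover have "y = (y(k + d := 0))(k + d := y (k + d))" by simp
    ultimately show "y \<in> {x(k + d := t) |x t. x \<in> ?P d}"
      using y by (intro CollectI exI[of _ "y(k + d := 0)"] exI[of _ "y (k + d)"]) simp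
  next
    fix y assume "y \<in> {x(k + d := t) |x t. x \<in> ?P d}"
    then obtain x t where y: "y = x(k + d := t)" "x \<in> ?P d" by blast
    have "coords k (\<lambda>j. j) y = coords k (\<lambda>j. j) x" using y(1) by (auto simp: coords_def)
    moreover have "y \<in> RR (k + Suc d)" using y by (auto simp: mem_RR)
    ultimately show "y \<in> ?P (Suc d)" using y by simp
  qed
  then show ?case using times_line[OF Suc.IH] by simp
qed

lemma space_times_definable:
  assumes "A \<in> S k"
  shows "{x \<in> RR (d + k). coords k (\<lambda>j. d + j) x \<in> A} \<in> S (d + k)"
proof (induction d)
  case 0
  have "{x \<in> RR (0 + k). coords k (\<lambda>j. 0 + j) x \<in> A} = A"
    using subset_space[OF assms] coords_id by fastforce
  then show ?case using assms by simp
next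
  case (Suc d)
  have "coords k (\<lambda>j. d + j) (\<lambda>i. x (Suc i)) = coords k (\<lambda>j. Suc d + j) x" for x
    by (auto simp: coords_def)
  moreover have "(\<lambda>i. x (Suc i)) \<in> RR (d + k)" if "x \<in> RR (Suc (d + k))" for x
    using that by (auto simp: mem_RR)
  ultimately have "{x \<in> RR (Suc d + k). coords k (\<lambda>j. Suc d + j) x \<in> A} =
      {x \<in> RR (Suc (d + k)). (\<lambda>i. x (Suc i)) \<in> {x \<in> RR (d + k). coords k (\<lambda>j. d + j) x \<in> A}}"
    by auto
  then show ?case using line_times[OF Suc.IH] by simp
qed

lemma coords_image_definable:
  assumes "A \<in> S (m + d)"
  shows "coords m (\<lambda>j. j) ` A \<in> S m"
  using assms
proof (induction d arbitrary: A)
  case 0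
  have "coords m (\<lambda>j. j) x = x" if "x \<in> A" for x
    using subset_space[OF 0] that coords_id by auto
  then have "coords m (\<lambda>j. j) ` A = A" by simp
  with 0 show ?case by simp
next
  case (Suc d)
  have "coords m (\<lambda>j. j) (x(m + d := 0)) = coords m (\<lambda>j. j) x" for x
    by (auto simp: coords_def)
  then have "coords m (\<lambda>j. j) ` A = coords m (\<lambda>j. j) ` (\<lambda>x. x(m + d := 0)) ` A"
    by (simp add: image_image)
  moreover have "(\<lambda>x. x(m + d := 0)) ` A \<in> S (m + d)"
    using Suc.prems by (intro projection) simp
  ultimately show ?case using Suc.IH by metis
qed

text \<open>
  The axioms provide the diagonal for the first and the last coordinate only.  The general one is
  that of \<open>R^(j - i + 1)\<close>, with \<open>i\<close> coordinates added in front and \<open>m - j - 1\<close> at the end.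
\<close>

lemma eq_coords_definable:
  assumes "i < m" "j < m"
  shows "{x \<in> RR m. x i = x j} \<in> S m"
proof -
  have *: "{x \<in> RR m. x i = x j} \<in> S m" if "i \<le> j" "j < m" for i j
  proof -
    have "{x \<in> RR (Suc (j - i)). x 0 = x (j - i)} \<in> S (Suc (j - i))" (is "?D \<in> _")
      using diagonal[of "Suc (j - i)"] by simp
    from space_times_definable[OF this, of i]
    have "{x \<in> RR (i + Suc (j - i)). coords (Suc (j - i)) (\<lambda>l. i + l) x \<in> ?D} \<in> S (i + Suc (j - i))"
      (is "?E \<in> _") .
    moreover have "i + Suc (j - i) = Suc j" using that by simp
    ultimately have E: "?E \<in> S (Suc j)" by simp
    have "{x \<in> RR (Suc j + (m - Suc j)). coords (Suc j) (\<lambda>l. l) x \<in> ?E} \<in> S (Suc j + (m - Suc j))"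
      using times_space_definable[OF E, of "m - Suc j"] .
    moreover have "Suc j + (m - Suc j) = m" using that by simp
    moreover have "coords (Suc j) (\<lambda>l. l) x \<in> ?E \<longleftrightarrow> x i = x j" for x
      using that by (auto simp: coords_def mem_RR)
    ultimately show ?thesis by simp
  qed
  show ?thesis
  proof (cases "i \<le> j")
    case False
    then show ?thesis using *[of j i] assms by (simp add: eq_commute)
  qed (use * assms in simp)
qed

lemma Ball_definable:
  fixes k :: nat
  assumes "\<And>j. j < k \<Longrightarrow> {x \<in> RR m. P j x} \<in> S m"
  shows "{x \<in> RR m. \<forall>j<k. P j x} \<in> S m"
  using assms
proof (induction k)
  case 0
  then show ?case using RR_definable by simp
next
  case (Suc k)
  have "{x \<in> RR m. \<forall>j<Suc k. P j x} = {x \<in> RR m. \<forall>j<k. P j x} \<inter> {x \<in> RR m. P k x}"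
    by (auto simp: less_Suc_eq)
  moreover have "{x \<in> RR m. \<forall>j<k. P j x} \<in> S m" "{x \<in> RR m. P k x} \<in> S m"
    using Suc by simp_all
  ultimately show ?case by (simp only: Int_definable)
qed

text \<open>
  Since projections can only forget last coordinates, the preimage is obtained by
  projecting the definable set of all \<open>(x, z)\<close> with \<open>z \<in> B\<close> and \<open>x (\<pi> j) = z j\<close> for all \<open>j < k\<close>.
\<close>

lemma coords_vimage_definable:
  assumes B: "B \<in> S k" and \<pi>: "\<And>j. j < k \<Longrightarrow> \<pi> j < m"
  shows "{x \<in> RR m. coords k \<pi> x \<in> B} \<in> S m"
proof -
  let ?E = "{y \<in> RR (m + k). coords k (\<lambda>j. m + j) y \<in> B} \<inter> {y \<in> RR (m + k). \<forall>j<k. y (\<pi> j) = y (m + j)}"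
  have "?E \<in> S (m + k)"
    using \<pi> by (intro Int_definable Ball_definable eq_coords_definable space_times_definable[OF B])
      (auto intro: trans_less_add1)
  then have "coords m (\<lambda>j. j) ` ?E \<in> S m" by (rule coords_image_definable)
  moreover have "coords m (\<lambda>j. j) ` ?E = {x \<in> RR m. coords k \<pi> x \<in> B}"
  proof (intro equalityI subsetI)
    fix x assume "x \<in> coords m (\<lambda>j. j) ` ?E"
    then obtain y where y: "y \<in> ?E" "x = coords m (\<lambda>j. j) y" by blast
    have "coords k \<pi> x = coords k (\<lambda>j. m + j) y"
      using y \<pi> by (auto simp: coords_def)
    moreover have "x \<in> RR m" using y(2) by (simp add: coords_def mem_RR)
    ultimately show "x \<in> {x \<in> RR m. coords k \<pi> x \<in> B}" using y by simp
  next
    fix x assume x: "x \<in> {x \<in> RR m. coords k \<pi> x \<in> B}"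
    define y where "y = (\<lambda>i. if i < m then x i else if i < m + k then x (\<pi> (i - m)) else 0)"
    have "coords k (\<lambda>j. m + j) y = coords k \<pi> x" by (auto simp: coords_def y_def)
    moreover have "y \<in> RR (m + k)" by (simp add: mem_RR y_def)
    moreover have "\<forall>j<k. y (\<pi> j) = y (m + j)" using \<pi> by (simp add: y_def)
    ultimately have "y \<in> ?E" using x by simp
    moreover have "coords m (\<lambda>j. j) y = x"
      using x by (auto simp: coords_def y_def mem_RR)
    ultimately show "x \<in> coords m (\<lambda>j. j) ` ?E" by blast
  qed
  ultimately show ?thesis by simp
qed

lemma slab_definable:
  assumes "is_interval T" "j < m"
  shows "{x \<in> RR m. x j \<in> T} \<in> S m"
proof -
  have T: "{x \<in> RR 1. x 0 \<in> T} \<in> S 1"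
    unfolding o_minimal by (rule exI[of _ "{T}"]) (use assms in auto)
  have "coords 1 (\<lambda>_. j) x \<in> {x \<in> RR 1. x 0 \<in> T} \<longleftrightarrow> x j \<in> T" for x
    by (simp add: coords_def mem_RR)
  then show ?thesis using coords_vimage_definable[OF T, of "\<lambda>_. j" m] assms(2) by simp
qed

lemma less_definable:
  assumes "i < m" "j < m"
  shows "{x \<in> RR m. x i < x j} \<in> S m"
proof -
  let ?\<pi> = "\<lambda>l. if l = 0 then i else j"
  have "coords 2 ?\<pi> x \<in> {x \<in> RR 2. x 0 < x 1} \<longleftrightarrow> x i < x j" for x
    by (simp add: coords_def mem_RR)
  then show ?thesis using coords_vimage_definable[OF order, of ?\<pi> m] assms by simp
qed

lemma shadow_definable:
  assumes G: "G \<in> S (Suc m)" and T: "is_interval T"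
  shows "shadow m T G \<in> S m"
proof -
  have "shadow m T G = (\<lambda>y. y(m := 0)) ` (G \<inter> {y \<in> RR (Suc m). y m \<in> T})"
    unfolding shadow_eq_image[OF subset_space[OF G]] using subset_space[OF G]
    by (intro arg_cong[of _ _ "image _"]) blast
  then show ?thesis using assms by (simp only: projection Int_definable slab_definable lessI)
qed

text \<open>
  The witness \<open>s\<close> becomes a new last coordinate, which is then projected away; substituting it for
  the coordinate with index \<open>m\<close> is an instance of \<open>coords_vimage_definable\<close>.
\<close>

lemma moved_along_line_definable:
  assumes A: "A \<in> S (Suc m)" and R: "R \<in> {(<), (>)}"
  shows "{y \<in> RR (Suc m). \<exists>s. R s (y m) \<and> y(m := s) \<in> A} \<in> S (Suc m)"
proof -
  let ?\<pi> = "\<lambda>j. if j = m then Suc m else j"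
  let ?M = "{z \<in> RR (Suc (Suc m)). R (z (Suc m)) (z m)} \<inter> {z \<in> RR (Suc (Suc m)). coords (Suc m) ?\<pi> z \<in> A}"
  have "{z \<in> RR (Suc (Suc m)). R (z (Suc m)) (z m)} \<in> S (Suc (Suc m))"
    using R less_definable[of m "Suc (Suc m)" "Suc m"] less_definable[of "Suc m" "Suc (Suc m)" m] by auto
  then have "?M \<in> S (Suc (Suc m))"
    by (intro Int_definable coords_vimage_definable[OF A]) auto
  then have "shadow (Suc m) UNIV ?M \<in> S (Suc m)" by (rule shadow_definable) simp
  moreover have "y(Suc m := s) \<in> ?M \<longleftrightarrow> R s (y m) \<and> y(m := s) \<in> A" if "y \<in> RR (Suc m)" for y s
  proof -
    have "coords (Suc m) ?\<pi> (y(Suc m := s)) = y(m := s)"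
      using that by (auto simp: coords_def mem_RR less_Suc_eq Suc_le_eq fun_eq_iff)
    moreover have "y(Suc m := s) \<in> RR (Suc (Suc m))" using that by (simp add: mem_RR)
    ultimately show ?thesis by simp
  qed
  ultimately show ?thesis unfolding shadow_def by (simp cong: conj_cong)
qed

text \<open>
  For \<open>R = (<)\<close> the value \<open>h x\<close> is the infimum of the fibre of \<open>A\<close> over \<open>x\<close>, for \<open>R = (>)\<close> the supremum.  In the
  first case \<open>{h x < t}\<close> is definable by moving \<open>A\<close> upwards, and the graph consists of the points with
  \<open>t \<le> h x\<close> above which there are no others with this property.
\<close>

lemma extremal_value_definable:
  assumes A: "A \<in> S (Suc m)" and R: "R \<in> {(<), (>)}"
    and h: "\<And>x t. x \<in> shadow m UNIV A \<Longrightarrow> R (h x) t \<longleftrightarrow> (\<exists>s. R s t \<and> x(m := s) \<in> A)"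
  shows "definable_fun S m (shadow m UNIV A) h"
proof -
  let ?V = "shadow m UNIV A"
  let ?C = "{x(m := t) |x t. x \<in> ?V}"
  let ?N = "?C - {y \<in> RR (Suc m). \<exists>s. R s (y m) \<and> y(m := s) \<in> A}"
  \<comment> \<open>For \<open>R = (<)\<close>, the set \<open>?N\<close> is the region on or below the graph and \<open>?H\<close> consists of its top points.\<close>
  let ?R' = "\<lambda>s t. R t s"
  let ?H = "?N - {y \<in> RR (Suc m). \<exists>s. ?R' s (y m) \<and> y(m := s) \<in> ?N}"
  have R': "?R' \<in> {(<), (>)}" using R by auto
  have "?C \<in> S (Suc m)" using A by (intro times_line shadow_definable) auto
  then have N: "?N \<in> S (Suc m)"
    by (rule Diff_definable) (rule moved_along_line_definable[OF A R])
  have "?H \<in> S (Suc m)"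
    using N by (rule Diff_definable) (rule moved_along_line_definable[OF N R'])
  moreover have "?H = {x(m := h x) |x. x \<in> ?V}"
  proof -
    have VR: "x \<in> RR m" if "x \<in> ?V" for x using that by (simp add: shadow_def)
    have C: "x(m := t) \<in> ?C \<longleftrightarrow> x \<in> ?V" if "x \<in> RR m" for x t
    proof
      assume "x(m := t) \<in> ?C"
      then obtain x' t' where x': "x(m := t) = x'(m := t')" "x' \<in> ?V" by blast
      have "x' \<in> RR m" using VR x' by blast
      with that have "x m = 0" "x' m = 0" by (simp_all add: mem_RR)
      then have "x = x'" using x'(1) by (metis fun_upd_triv fun_upd_upd)
      with x' show "x \<in> ?V" by simp
    qed blast
    have up: "x(m := t) \<in> RR (Suc m)" if "x \<in> RR m" for x t using that by (simp add: mem_RR)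
    have N: "x(m := t) \<in> ?N \<longleftrightarrow> x \<in> ?V \<and> \<not> R (h x) t" if "x \<in> RR m" for x t
      using C[OF that] up[OF that] h[of x t] by auto
    have H: "x(m := t) \<in> ?H \<longleftrightarrow> x \<in> ?V \<and> t = h x" if "x \<in> RR m" for x t
    proof -
      have "x(m := t) \<in> ?H \<longleftrightarrow> x(m := t) \<in> ?N \<and> \<not> (\<exists>s. R t s \<and> x(m := s) \<in> ?N)"
        using up[OF that, of t] by simp
      also have "\<dots> \<longleftrightarrow> x \<in> ?V \<and> \<not> R (h x) t \<and> \<not> (\<exists>s. R t s \<and> \<not> R (h x) s)"
        unfolding N[OF that] by blast
      also have "\<dots> \<longleftrightarrow> x \<in> ?V \<and> t = h x"
        using R by (auto simp: not_less) (metis less_irrefl order_le_imp_less_or_eq)+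
      finally show ?thesis .
    qed
    show ?thesis
    proof (intro equalityI subsetI)
      fix y assume y: "y \<in> ?H"
      then obtain x t where xt: "y = x(m := t)" "x \<in> ?V" by blast
      have "x \<in> ?V \<and> t = h x" by (rule iffD1[OF H[OF VR[OF xt(2)]] y[unfolded xt(1)]])
      with xt show "y \<in> {x(m := h x) |x. x \<in> ?V}" by blast
    next
      fix y assume "y \<in> {x(m := h x) |x. x \<in> ?V}"
      then obtain x where y: "y = x(m := h x)" "x \<in> ?V" by blast
      show "y \<in> ?H"
        unfolding y(1) by (intro iffD2[OF H[OF VR[OF y(2)]]] conjI y(2) refl)
    qed
  qed
  ultimately show ?thesis unfolding definable_fun_def by simp
qed

lemma semi_monotone_shadow:
  assumes U: "semi_monotone S (Suc m) U" and T: "T \<in> coord_conditions"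
  shows "semi_monotone S m (shadow m T U)"
proof -
  have U': "U \<in> S (Suc m)" "openin (Euclidean_space (Suc m)) U" "bounded_in (Suc m) U"
    "section_connected (Suc m) U"
    using U by (simp_all add: semi_monotone_iff)
  obtain B where B: "\<And>x i. x \<in> U \<Longrightarrow> i < Suc m \<Longrightarrow> \<bar>x i\<bar> \<le> B"
    using U'(3) unfolding bounded_in_def by blast
  have "\<bar>x i\<bar> \<le> B" if "x \<in> shadow m T U" "i < m" for x i
  proof -
    obtain t where "x(m := t) \<in> U" using \<open>x \<in> shadow m T U\<close> by (auto simp: shadow_def)
    from B[OF this, of i] \<open>i < m\<close> show ?thesis by simp
  qed
  then have "bounded_in m (shadow m T U)" unfolding bounded_in_def by blast
  then show ?thesis
    using U' T openin_shadow shadow_definable is_interval_coord_condition subset_space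
    by (simp add: semi_monotone_iff section_connected_shadow)
qed

end


section \<open>The characterisation\<close>

lemma open_interval_of_bounded:
  fixes I :: "real set"
  assumes "open I" "connected I" and ne: "I \<noteq> {}" and bdd: "\<And>t. t \<in> I \<Longrightarrow> \<bar>t\<bar> \<le> B"
  shows "\<exists>a b. a < b \<and> \<bar>a\<bar> \<le> B \<and> \<bar>b\<bar> \<le> B \<and> I = {a<..<b}"
proof -
  have bb: "bdd_below I" "bdd_above I"
    using bdd by (auto intro!: bdd_belowI[of _ "- B"] bdd_aboveI[of _ B] simp: abs_le_iff) fastforce+
  have sub: "t \<in> {Inf I<..<Sup I}" if t: "t \<in> I" for t
  proof -
    obtain e where e: "e > 0" "ball t e \<subseteq> I" using assms(1) t openE by blast
    then have "t - e/2 \<in> I" "t + e/2 \<in> I" by (auto simp: dist_real_def subset_iff)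
    with bb have "Inf I \<le> t - e/2" "t + e/2 \<le> Sup I" by (auto intro: cInf_lower cSup_upper)
    with e show ?thesis by simp
  qed
  moreover have "t \<in> I" if t: "t \<in> {Inf I<..<Sup I}" for t
  proof -
    obtain u v where "u \<in> I" "u < t" "v \<in> I" "t < v"
      using t ne bb by (auto simp: cInf_less_iff less_cSup_iff)
    then show ?thesis
      using assms(2) unfolding connected_iff_interval by (meson less_imp_le)
  qed
  ultimately have I: "I = {Inf I<..<Sup I}" by blast
  obtain t where t: "t \<in> I" using ne by blast
  with sub have "Inf I < Sup I" by fastforce
  moreover have "- B \<le> Inf I" "Sup I \<le> B"
    using bdd ne by (auto intro!: cInf_greatest cSup_least simp: abs_le_iff) fastforce+
  ultimately show ?thesis using I by (intro exI[of _ "Inf I"] exI[of _ "Sup I"]) auto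
qed

text \<open>
  Upper semi-continuity comes for free: the sublevel set of \<open>r\<close> is itself an open neighbourhood of each
  point at which \<open>f\<close> is below \<open>r\<close>.
\<close>

lemma submonotoneI:
  assumes V: "semi_monotone S m V" and bdd: "\<And>x. x \<in> V \<Longrightarrow> \<bar>f x\<bar> \<le> B"
    and sub: "\<And>r. semi_monotone S m {x \<in> V. f x < r}"
  shows "submonotone S m V f"
  unfolding submonotone_def
proof (intro conjI)
  show "bounded (f ` V)" using bdd by (auto simp: bounded_iff)
  show "upper_semicontinuous_on m V f"
    unfolding upper_semicontinuous_on_def
  proof (intro ballI allI impI)
    fix x r assume "x \<in> V" "f x < r"
    with sub[of r] show "\<exists>W. openin (Euclidean_space m) W \<and> x \<in> W \<and> (\<forall>y\<in>W \<inter> V. f y < r)"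
      by (intro exI[of _ "{x \<in> V. f x < r}"]) (simp add: semi_monotone_iff)
  qed
qed (use V sub in auto)

text \<open>
  The restriction to \<open>r > inf f\<close> in the definition of submonotone functions is harmless, because all other
  sublevel sets are empty.
\<close>

lemma submonotone_sublevel:
  assumes f: "submonotone S m V f"
  shows "openin (Euclidean_space m) {x \<in> V. f x < r}" "section_connected m {x \<in> V. f x < r}"
proof -
  have "openin (Euclidean_space m) {x \<in> V. f x < r} \<and> section_connected m {x \<in> V. f x < r}"
  proof (cases "r > (INF x\<in>V. f x)")
    case True
    then show ?thesis using f by (auto simp: submonotone_def semi_monotone_iff)
  next
    case False
    have "bdd_below (f ` V)" using f by (simp add: submonotone_def bounded_imp_bdd_below)
    then have "(INF x\<in>V. f x) \<le> f x" if "x \<in> V" for x using that by (rule cINF_lower)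
    with False have "{x \<in> V. f x < r} = {}" by fastforce
    then show ?thesis by (simp only:) (simp add: section_connected_def)
  qed
  then show "openin (Euclidean_space m) {x \<in> V. f x < r}" "section_connected m {x \<in> V. f x < r}"
    by simp_all
qed

text \<open>
  The functions are the end points of the fibres.  Density of the reals turns \<open>f x < t\<close> into the existence of
  a point of \<open>U\<close> over \<open>x\<close> below \<open>t\<close>, and \<open>t < g x\<close> into that of a point above \<open>t\<close>.  From these two
  descriptions the level sets are recognised as shadows, and the graphs as definable sets.
\<close>

lemma semi_monotone_imp_between:
  assumes S: "o_minimal_structure S" and U: "semi_monotone S (Suc m) U"
  obtains f g where
    "definable_fun S m (shadow m UNIV U) f" "submonotone S m (shadow m UNIV U) f"
    "definable_fun S m (shadow m UNIV U) g" "supermonotone S m (shadow m UNIV U) g"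
    "\<And>x. x \<in> shadow m UNIV U \<Longrightarrow> f x < g x"
    "U = {x(m := t) |x t. x \<in> shadow m UNIV U \<and> f x < t \<and> t < g x}"
proof -
  interpret o_minimal_structure S by fact
  let ?V = "shadow m UNIV U"
  have U': "U \<in> S (Suc m)" "openin (Euclidean_space (Suc m)) U" "bounded_in (Suc m) U"
    "section_connected (Suc m) U"
    using U by (simp_all add: semi_monotone_iff)
  note UR = subset_space[OF U'(1)]
  obtain B where B: "\<And>x i. x \<in> U \<Longrightarrow> i < Suc m \<Longrightarrow> \<bar>x i\<bar> \<le> B"
    using U'(3) unfolding bounded_in_def by blast
  have "\<forall>x\<in>?V. \<exists>a b. a < b \<and> \<bar>a\<bar> \<le> B \<and> \<bar>b\<bar> \<le> B \<and> {t. x(m := t) \<in> U} = {a<..<b}"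
  proof
    fix x assume "x \<in> ?V"
    then have x: "x \<in> RR m" "{t. x(m := t) \<in> U} \<noteq> {}" by (auto simp: shadow_def)
    have "\<bar>t\<bar> \<le> B" if "t \<in> {t. x(m := t) \<in> U}" for t
      using that B[of "x(m := t)" m] by simp
    moreover have "connected {t. x(m := t) \<in> U}"
      using section_connected_fibre[OF U'(4) _ x(1) UR, of UNIV] by simp
    ultimately show "\<exists>a b. a < b \<and> \<bar>a\<bar> \<le> B \<and> \<bar>b\<bar> \<le> B \<and> {t. x(m := t) \<in> U} = {a<..<b}"
      using open_fibre[OF U'(2) x(1)] x(2) by (intro open_interval_of_bounded) auto
  qed
  from bchoice[OF this] obtain f where
    "\<forall>x\<in>?V. \<exists>b. f x < b \<and> \<bar>f x\<bar> \<le> B \<and> \<bar>b\<bar> \<le> B \<and> {t. x(m := t) \<in> U} = {f x<..<b}" ..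
  from bchoice[OF this] obtain g where
    fg: "\<forall>x\<in>?V. f x < g x \<and> \<bar>f x\<bar> \<le> B \<and> \<bar>g x\<bar> \<le> B \<and> {t. x(m := t) \<in> U} = {f x<..<g x}" ..
  then have less: "f x < g x" and bdd: "\<bar>f x\<bar> \<le> B" "\<bar>g x\<bar> \<le> B" if "x \<in> ?V" for x
    using that by blast+
  have mem: "x(m := t) \<in> U \<longleftrightarrow> f x < t \<and> t < g x" if "x \<in> ?V" for x t
    using bspec[OF fg that] by (simp add: set_eq_iff)
  have below: "f x < t \<longleftrightarrow> (\<exists>s<t. x(m := s) \<in> U)" if "x \<in> ?V" for x t
    unfolding mem[OF that] using less[OF that] dense[of "f x" "min t (g x)"] by auto
  have above: "t < g x \<longleftrightarrow> (\<exists>s>t. x(m := s) \<in> U)" if "x \<in> ?V" for x t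
    unfolding mem[OF that] using less[OF that] dense[of "max t (f x)" "g x"] by auto
  have f_sub: "{x \<in> ?V. f x < r} = shadow m {..<r} U" for r
    using below by (auto simp: shadow_def)
  have g_sub: "{x \<in> ?V. - g x < r} = shadow m {- r<..} U" for r
  proof -
    have "- g x < r \<longleftrightarrow> (\<exists>s>- r. x(m := s) \<in> U)" if "x \<in> ?V" for x
      using above[OF that, of "- r"] by (simp add: minus_less_iff)
    then show ?thesis by (auto simp: shadow_def)
  qed
  show thesis
  proof (rule that)
    show "definable_fun S m ?V f"
      using below by (intro extremal_value_definable[OF U'(1), of "(<)"]) auto
    show "definable_fun S m ?V g"
      using above by (intro extremal_value_definable[OF U'(1), of "(>)"]) auto
    show "submonotone S m ?V f"
      using semi_monotone_shadow[OF U] bdd f_sub by (intro submonotoneI) auto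
    show "supermonotone S m ?V g"
      unfolding supermonotone_def
      using semi_monotone_shadow[OF U] bdd g_sub by (intro submonotoneI) auto
    show "f x < g x" if "x \<in> ?V" for x using less[OF that] .
    show "U = {x(m := t) |x t. x \<in> ?V \<and> f x < t \<and> t < g x}"
    proof (intro equalityI subsetI)
      fix y assume y: "y \<in> U"
      then have "y \<in> RR (Suc m)" using UR by blast
      have "y(m := 0) \<in> ?V" using y UR by (auto simp: shadow_eq_image)
      moreover from this have "f (y(m := 0)) < y m \<and> y m < g (y(m := 0))"
        using mem[of "y(m := 0)" "y m"] y by simp
      ultimately show "y \<in> {x(m := t) |x t. x \<in> ?V \<and> f x < t \<and> t < g x}"
        by (intro CollectI exI[of _ "y(m := 0)"] exI[of _ "y m"]) simp
    qed (use mem in blast)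
  qed
qed

text \<open>
  The four kinds of conditions on the last coordinate give the bases \<open>V\<close>, \<open>{f < c}\<close>, \<open>{g > c}\<close> and
  \<open>{f < c} \<inter> {g > c}\<close>; the last one is covered by \<open>section_connected_Int\<close>.
\<close>

lemma between_imp_section_connected:
  assumes U: "openin (Euclidean_space (Suc m)) U"
    and V: "section_connected m V" "V \<subseteq> RR m"
    and f: "submonotone S m V f" and g: "supermonotone S m V g"
    and less: "\<And>x. x \<in> V \<Longrightarrow> f x < g x"
    and U_eq: "U = {x(m := t) |x t. x \<in> V \<and> f x < t \<and> t < g x}"
  shows "section_connected (Suc m) U"
proof (rule section_connected_Suc[OF U])
  have mem: "x(m := t) \<in> U \<longleftrightarrow> x \<in> V \<and> f x < t \<and> t < g x" if "x \<in> RR m" for x t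
  proof
    assume "x(m := t) \<in> U"
    then obtain x' t' where x': "x(m := t) = x'(m := t')" "x' \<in> V" "f x' < t'" "t' < g x'"
      unfolding U_eq by blast
    have "x' \<in> RR m" using x' V(2) by blast
    with that have "x m = 0" "x' m = 0" by (simp_all add: mem_RR)
    then have "x = x'" "t = t'" using x'(1) by (metis fun_upd_triv fun_upd_upd, metis fun_upd_same)
    with x' show "x \<in> V \<and> f x < t \<and> t < g x" by simp
  next
    assume "x \<in> V \<and> f x < t \<and> t < g x"
    then show "x(m := t) \<in> U"
      unfolding U_eq by (intro CollectI exI[of _ x] exI[of _ t] conjI refl) simp_all
  qed
  {
    fix x :: "nat \<Rightarrow> real" assume x: "x \<in> RR m"
    have "{t. x(m := t) \<in> U} = (if x \<in> V then {f x<..<g x} else {})"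
      unfolding mem[OF x] by auto
    then show "connected {t. x(m := t) \<in> U}" by simp
  next
    fix T assume T: "T \<in> coord_conditions"
    have sh: "shadow m T U = {x \<in> V. \<exists>t\<in>T. f x < t \<and> t < g x}"
    proof (intro equalityI subsetI)
      fix x assume "x \<in> shadow m T U"
      then obtain t where t: "x \<in> RR m" "t \<in> T" "x(m := t) \<in> U" unfolding shadow_def by blast
      with iffD1[OF mem[OF t(1)] t(3)] show "x \<in> {x \<in> V. \<exists>t\<in>T. f x < t \<and> t < g x}" by blast
    next
      fix x assume "x \<in> {x \<in> V. \<exists>t\<in>T. f x < t \<and> t < g x}"
      then obtain t where t: "t \<in> T" "x \<in> V \<and> f x < t \<and> t < g x" by blast
      with V(2) have "x \<in> RR m" by blast
      with iffD2[OF mem[OF this] t(2)] t(1) show "x \<in> shadow m T U" unfolding shadow_def by blast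
    qed
    note F = submonotone_sublevel[OF f]
    note G = submonotone_sublevel[OF g[unfolded supermonotone_def]]
    show "section_connected m (shadow m T U)"
      using T
    proof (cases rule: coord_conditions_cases)
      case 1
      have "shadow m T U = V" unfolding sh unfolding 1 using dense[OF less] by blast
      with V show ?thesis by simp
    next
      case (2 c)
      have "shadow m T U = {x \<in> V. f x < c}"
      proof -
        have "(\<exists>t\<in>{..<c}. f x < t \<and> t < g x) \<longleftrightarrow> f x < c" if "x \<in> V" for x
          using less[OF that] dense[of "f x" "min c (g x)"] by auto
        then show ?thesis unfolding sh unfolding 2 by blast
      qed
      with F show ?thesis by simp
    next
      case (3 c)
      have "shadow m T U = {x \<in> V. - g x < - c}"
      proof -
        have "(\<exists>t\<in>{c<..}. f x < t \<and> t < g x) \<longleftrightarrow> - g x < - c" if "x \<in> V" for x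
          using less[OF that] dense[of "max c (f x)" "g x"] by auto
        then show ?thesis unfolding sh unfolding 3 by blast
      qed
      then show ?thesis using G(2)[of "- c"] by (simp only:)
    next
      case (4 c)
      have "shadow m T U = {x \<in> V. f x < c} \<inter> {x \<in> V. - g x < - c}"
        unfolding sh unfolding 4 by auto
      moreover have "{x \<in> V. f x < c} \<union> {x \<in> V. - g x < - c} = V"
        using less by fastforce
      ultimately show ?thesis
        using section_connected_Int[OF F(1) G(1) F(2) G(2), of c "- c"] V(1) by (simp only:)
    qed
  }
qed

text \<open>
  Here \<open>R^1\<close> is treated as \<open>R^(0 + 1)\<close>, so that \<open>U\<close> has a single fibre, over the only point of \<open>R^0\<close>.
\<close>

lemma section_connected_line_iff:
  assumes U: "openin (Euclidean_space 1) U" and bdd: "bounded_in 1 U"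
  shows "section_connected 1 U \<longleftrightarrow> (\<exists>a b. U = {x \<in> RR 1. a < x 0 \<and> x 0 < b})"
proof
  let ?z = "\<lambda>_::nat. 0 :: real"
  have U': "openin (Euclidean_space (Suc 0)) U" using U by simp
  have UR: "U \<subseteq> RR (Suc 0)" using openin_subset[OF U'] .
  have z: "?z \<in> RR 0" by (simp add: mem_RR)
  have line: "x = ?z(0 := x 0)" if "x \<in> RR (Suc 0)" for x
    using that by (auto simp: mem_RR Suc_le_eq)
  {
    assume sc: "section_connected 1 U"
    let ?I = "{t. ?z(0 := t) \<in> U}"
    obtain B where B: "\<And>x. x \<in> U \<Longrightarrow> \<bar>x 0\<bar> \<le> B"
      using bdd unfolding bounded_in_def by auto
    have "\<exists>a b. ?I = {a<..<b}"
    proof (cases "?I = {}")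
      case True
      \<comment> \<open>The empty set is an open interval with \<open>a \<ge> b\<close>.\<close>
      then have "?I = {0<..<0}" by simp
      then show ?thesis by blast
    next
      case False
      have "connected ?I" using section_connected_fibre[of 0 U UNIV ?z] sc z UR by simp
      moreover have "\<bar>t\<bar> \<le> B" if "t \<in> ?I" for t using that B[of "?z(0 := t)"] by simp
      ultimately show ?thesis
        using open_interval_of_bounded[OF open_fibre[OF U' z] _ False, of B] by blast
    qed
    then obtain a b where I: "?I = {a<..<b}" by blast
    have "x \<in> U \<longleftrightarrow> a < x 0 \<and> x 0 < b" if "x \<in> RR (Suc 0)" for x
    proof -
      have "x \<in> U \<longleftrightarrow> x 0 \<in> ?I" using line[OF that] by simp
      then show ?thesis unfolding I by simp
    qed
    with UR have "U = {x \<in> RR 1. a < x 0 \<and> x 0 < b}" unfolding One_nat_def by blast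
    then show "\<exists>a b. U = {x \<in> RR 1. a < x 0 \<and> x 0 < b}" by blast
  next
    assume "\<exists>a b. U = {x \<in> RR 1. a < x 0 \<and> x 0 < b}"
    then obtain a b where U_eq: "U = {x \<in> RR 1. a < x 0 \<and> x 0 < b}" by blast
    have "section_connected (Suc 0) U"
    proof (rule section_connected_Suc[OF U'])
      fix x :: "nat \<Rightarrow> real" assume "x \<in> RR 0"
      then have "{t. x(0 := t) \<in> U} = {a<..<b}"
        unfolding U_eq by (auto simp: mem_RR)
      then show "connected {t. x(0 := t) \<in> U}" by simp
    qed (auto intro!: section_connected_0 simp: shadow_def)
    then show "section_connected 1 U" by simp
  }
qed

theorem theorem1p7:
  fixes S :: "nat \<Rightarrow> (nat \<Rightarrow> real) set set"
    and n :: nat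
    and U :: "(nat \<Rightarrow> real) set"
  assumes "o_minimal_structure S"
    and "n \<ge> 1"
    and "U \<in> S n"
    and "openin (Euclidean_space n) U"
    and "bounded_in n U"
  shows "semi_monotone S n U \<longleftrightarrow>
    (n = 1 \<longrightarrow> (\<exists>a b. U = {x \<in> RR 1. a < x 0 \<and> x 0 < b})) \<and>
    (n \<ge> 2 \<longrightarrow> (\<exists>U' f g.
        semi_monotone S (n - 1) U' \<and>
        definable_fun S (n - 1) U' f \<and> submonotone S (n - 1) U' f \<and>
        definable_fun S (n - 1) U' g \<and> supermonotone S (n - 1) U' g \<and>
        (\<forall>x\<in>U'. f x < g x) \<and>
        U = {x(n - 1 := t) |x t. x \<in> U' \<and> f x < t \<and> t < g x}))"
proof -
  interpret o_minimal_structure S by fact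
  have iff: "semi_monotone S n U \<longleftrightarrow> section_connected n U"
    using assms by (simp add: semi_monotone_iff)
  show ?thesis
  proof (cases "n = 1")
    case True
    then show ?thesis
      using section_connected_line_iff[of U] assms iff by simp
  next
    case False
    define m where "m = n - 1"
    have m: "n = Suc m" "n \<ge> 2" using assms(2) False by (simp_all add: m_def)
    have "semi_monotone S (Suc m) U \<longleftrightarrow> (\<exists>U' f g.
        semi_monotone S m U' \<and>
        definable_fun S m U' f \<and> submonotone S m U' f \<and>
        definable_fun S m U' g \<and> supermonotone S m U' g \<and>
        (\<forall>x\<in>U'. f x < g x) \<and>
        U = {x(m := t) |x t. x \<in> U' \<and> f x < t \<and> t < g x})" (is "_ \<longleftrightarrow> ?R")
    proof
      assume U: "semi_monotone S (Suc m) U"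
      have V: "semi_monotone S m (shadow m UNIV U)" using semi_monotone_shadow[OF U] by simp
      obtain f g where fg:
        "definable_fun S m (shadow m UNIV U) f" "submonotone S m (shadow m UNIV U) f"
        "definable_fun S m (shadow m UNIV U) g" "supermonotone S m (shadow m UNIV U) g"
        "\<And>x. x \<in> shadow m UNIV U \<Longrightarrow> f x < g x"
        "U = {x(m := t) |x t. x \<in> shadow m UNIV U \<and> f x < t \<and> t < g x}"
        using semi_monotone_imp_between[OF assms(1) U] by blast
      show ?R
        by (intro exI[of _ "shadow m UNIV U"] exI[of _ f] exI[of _ g] conjI ballI V fg)
    next
      assume ?R
      then obtain V f g where V: "semi_monotone S m V"
        and f: "submonotone S m V f" and g: "supermonotone S m V g"
        and less: "\<And>x. x \<in> V \<Longrightarrow> f x < g x"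
        and U_eq: "U = {x(m := t) |x t. x \<in> V \<and> f x < t \<and> t < g x}"
        by blast
      have "V \<subseteq> RR m" "section_connected m V" using V subset_space by (auto simp only: semi_monotone_iff)
      with assms(4) have "section_connected (Suc m) U"
        unfolding m(1) by (intro between_imp_section_connected[OF _ _ _ f g less U_eq])
      then show "semi_monotone S (Suc m) U" using iff m by simp
    qed
    then show ?thesis using m by simp
  qed
qed

end
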